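(* Let $n$ be a positive odd integer. There are no continuous inverse ambiguous functions on $GL_n^+(\mathbb{R})$, the multiplicative group of real $n \times n$ matrices with positive determinant.
   Context: For a group $G$, a function $f : G \to G$ is called inverse ambiguous if it is bijective and its inverse function satisfies $f^{-1}(x) = (f(x))^{-1}$ for all $x \in G$, where the right-hand side is the group inverse of $f(x)$. Equivalently, $f(f(x)) = x^{-1}$ for all $x \in G$. $GL_n^+(\mathbb{R})$ has the subspace topology from the space of real $n \times n$ matrices. *)

theory Defs
  imports "HOL-Analysis.Analysis" "HOL-Algebra.Group"
begin

text \<open>
  Functions between carriers are represented by total functions, of which only the values on
  the carrier matter; the functional inverse is therefore \<open>inv_into\<close> relative to
  the carrier.
\<close>

definition inverse_ambiguous :: "('a, 'b) monoid_scheme \<Rightarrow> ('a \<Rightarrow> 'a) \<Rightarrow> bool" where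
  "inverse_ambiguous G f \<longleftrightarrow>
     bij_betw f (carrier G) (carrier G) \<and>
     (\<forall>x\<in>carrier G. inv_into (carrier G) f x = inv\<^bsub>G\<^esub> (f x))"

definition GL_pos :: "(real ^ 'n ^ 'n) monoid" where
  "GL_pos = \<lparr>carrier = {A. det A > 0}, mult = (**), one = mat 1\<rparr>"

lemma group_GL_pos: "group (GL_pos :: (real ^ 'n ^ 'n) monoid)"
proof (rule groupI)
  fix A :: "real ^ 'n ^ 'n"
  assume "A \<in> carrier GL_pos"
  then have A: "det A > 0" by (simp add: GL_pos_def)
  then obtain B where B: "B ** A = mat 1"
    using invertible_det_nz[of A] unfolding invertible_def by auto
  then have "det B * det A = 1"
    by (metis det_mul det_I)
  then have "det B > 0"
    using A by (metis zero_less_mult_pos2 zero_less_one)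
  with B show "\<exists>B\<in>carrier GL_pos. B \<otimes>\<^bsub>GL_pos\<^esub> A = \<one>\<^bsub>GL_pos\<^esub>"
    by (auto simp: GL_pos_def)
qed (auto simp: GL_pos_def det_mul matrix_mul_assoc)

lemma inverse_ambiguous_iff:
  assumes "group G" and f: "f \<in> carrier G \<rightarrow> carrier G"
  shows "inverse_ambiguous G f \<longleftrightarrow> (\<forall>x\<in>carrier G. f (f x) = inv\<^bsub>G\<^esub> x)"
proof -
  interpret group G by fact
  show ?thesis
  proof
    assume "inverse_ambiguous G f"
    then have bij: "bij_betw f (carrier G) (carrier G)"
      and inv: "\<And>x. x \<in> carrier G \<Longrightarrow> inv_into (carrier G) f x = inv\<^bsub>G\<^esub> (f x)"
      by (auto simp: inverse_ambiguous_def)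
    show "\<forall>x\<in>carrier G. f (f x) = inv\<^bsub>G\<^esub> x"
    proof
      fix x assume x: "x \<in> carrier G"
      then have fx: "f x \<in> carrier G" using f by auto
      have "x = inv_into (carrier G) f (f x)"
        using bij x by (simp add: bij_betw_inv_into_left)
      also have "\<dots> = inv\<^bsub>G\<^esub> (f (f x))"
        using inv fx by simp
      finally show "f (f x) = inv\<^bsub>G\<^esub> x"
        using f fx by (metis inv_inv Pi_mem)
    qed
  next
    assume ff: "\<forall>x\<in>carrier G. f (f x) = inv\<^bsub>G\<^esub> x"
    have inj: "inj_on f (carrier G)"
      by (rule inj_onI) (metis ff inv_inv)
    have comm: "f (inv\<^bsub>G\<^esub> x) = inv\<^bsub>G\<^esub> (f x)" if "x \<in> carrier G" for x
      using ff f that by (metis Pi_mem)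
    have right: "f (inv\<^bsub>G\<^esub> (f x)) = x" if "x \<in> carrier G" for x
      using ff f that comm[of "f x"] by (auto simp: Pi_iff)
    have "bij_betw f (carrier G) (carrier G)"
      unfolding bij_betw_def
    proof (intro conjI inj equalityI subsetI)
      fix y assume "y \<in> f ` carrier G"
      then show "y \<in> carrier G" using f by auto
    next
      fix y assume y: "y \<in> carrier G"
      show "y \<in> f ` carrier G"
        using right[OF y] f y by (metis Pi_mem imageI inv_closed)
    qed
    moreover have "inv_into (carrier G) f x = inv\<^bsub>G\<^esub> (f x)" if "x \<in> carrier G" for x
      using right[OF that] f that by (intro inv_into_f_eq[OF inj]) auto
    ultimately show "inverse_ambiguous G f"
      by (auto simp: inverse_ambiguous_def)
  qed
qed

end

(* Let f be a continuous inverse ambiguous function. It commutes with inversion, so it restricts to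
   a homeomorphism of the set of involutions of positive determinant. For odd n, the identity is
   the only isolated point of this set: another such p satisfies p ~= I and p ~= -I, and lies on a
   line p + s N of involutions with N = (I + p) X (I - p) ~= 0. Hence f(I) = I. The normalised
   restriction H of f to a small sphere around I then satisfies H o H ~ antipode, since inversion
   reverses directions at I. The sphere has even dimension n^2 - 1, so the antipode has degree -1,
   whereas H o H has degree (deg H)^2. *)

theory Submission
  imports Defs "HOL-Homology.Brouwer_Degree"
begin

section \<open>The antipodal map of an even-dimensional sphere\<close>

abbreviation nsphere_reflection :: "nat \<Rightarrow> (nat \<Rightarrow> real) \<Rightarrow> nat \<Rightarrow> real" where
  "nsphere_reflection k \<equiv> \<lambda>x i. if i = k then - x i else x i"

text \<open>As a subspace of the product space, the sphere is accessible to
  \<open>continuous_on\<close> facts.\<close>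

lemma nsphere_eq_top_of_set:
  "nsphere n = top_of_set {x. (\<Sum>i\<le>n. (x i)\<^sup>2) = 1 \<and> (\<forall>i>n. x i = 0)}"
  by (simp add: nsphere euclidean_product_topology)

lemma Brouwer_degree2_involution:
  assumes "continuous_map (nsphere p) (nsphere p) g" "g \<circ> g = id"
  shows "Brouwer_degree2 p g * Brouwer_degree2 p g = 1"
  using Brouwer_degree2_compose[OF assms(1) assms(1)] assms(2) by simp

lemma continuous_map_nsphere_swap:
  assumes "k \<le> n"
  shows "continuous_map (nsphere n) (nsphere n) (\<lambda>x i. x (Transposition.transpose 0 k i))"
proof -
  have "continuous_on S (\<lambda>x::nat\<Rightarrow>real. \<lambda>i. x (Transposition.transpose 0 k i))" for S
    by (intro continuous_on_coordinatewise_then_product)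
      (auto intro: continuous_on_subset[OF continuous_on_product_coordinates])
  moreover have "(\<Sum>i\<le>n. (x (Transposition.transpose 0 k i))\<^sup>2) = (\<Sum>i\<le>n. (x i)\<^sup>2)" for x :: "nat \<Rightarrow> real"
    using assms
    by (intro sum.reindex_bij_witness[of _ "Transposition.transpose 0 k" "Transposition.transpose 0 k"])
      (auto simp: Transposition.transpose_def)
  moreover have "Transposition.transpose 0 k i = i" if "i > n" for i
    using assms that by (auto simp: Transposition.transpose_def)
  ultimately show ?thesis
    by (auto simp: nsphere_eq_top_of_set)
qed

text \<open>Swapping coordinates 0 and \<open>k\<close> conjugates this map to the reflection in
  coordinate 0. The sign of the swap's degree is irrelevant: it enters squared.\<close>

lemma Brouwer_degree2_coordinate_reflection:
  assumes "k \<le> p"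
  shows "Brouwer_degree2 p (nsphere_reflection k) = -1"
proof -
  let ?s = "\<lambda>x::nat\<Rightarrow>real. \<lambda>i. x (Transposition.transpose 0 k i)"
  have s: "continuous_map (nsphere p) (nsphere p) ?s"
    by (rule continuous_map_nsphere_swap[OF assms])
  have r: "continuous_map (nsphere p) (nsphere p) (nsphere_reflection 0)"
    by (rule continuous_map_nsphere_reflection)
  have eq: "nsphere_reflection k = ?s \<circ> (nsphere_reflection 0 \<circ> ?s)"
    by (auto simp: fun_eq_iff Transposition.transpose_def)
  have "Brouwer_degree2 p ?s * Brouwer_degree2 p ?s = 1"
    by (rule Brouwer_degree2_involution[OF s]) (auto simp: fun_eq_iff)
  then show ?thesis
    unfolding eq
    by (simp add: Brouwer_degree2_compose[OF _ s] Brouwer_degree2_compose[OF s r] r s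
        continuous_map_compose[OF s r] Brouwer_degree2_reflection)
qed

lemma Brouwer_degree2_antipodal:
  "Brouwer_degree2 p (\<lambda>x i. - x i) = (-1) ^ Suc p"
proof -
  \<comment> \<open>These maps lead from the identity to the antipode by one reflection at a time,
    each contributing a factor -1.\<close>
  let ?r = "\<lambda>(k::nat) x i. if i < k then - x i else (x i :: real)"
  have "continuous_map (nsphere p) (nsphere p) (?r k) \<and> Brouwer_degree2 p (?r k) = (-1) ^ k"
    if "k \<le> Suc p" for k
    using that
  proof (induction k)
    case 0
    have "?r 0 = id" by (simp add: fun_eq_iff)
    then show ?case by (simp only: continuous_map_id Brouwer_degree2_id power_0 simp_thms)
  next
    case (Suc k)
    have eq: "?r (Suc k) = nsphere_reflection k \<circ> ?r k"
      by (auto simp: fun_eq_iff)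
    show ?case
      unfolding eq using Suc
      by (simp add: Brouwer_degree2_compose continuous_map_nsphere_reflection
          Brouwer_degree2_coordinate_reflection
          continuous_map_compose[OF _ continuous_map_nsphere_reflection])
  qed
  from this[of "Suc p"] have "Brouwer_degree2 p (?r (Suc p)) = (-1) ^ Suc p"
    by simp
  \<comment> \<open>The two maps differ only in coordinates above \<open>p\<close>, which vanish on
    the sphere.\<close>
  moreover have "Brouwer_degree2 p (\<lambda>x i. - x i) = Brouwer_degree2 p (?r (Suc p))"
    by (rule Brouwer_degree2_eq) (auto simp: nsphere fun_eq_iff)
  ultimately show ?thesis by simp
qed

text \<open>Degree is multiplicative, so the degree of \<open>h\<close> would be an integer with
  square -1, the degree of the antipode of an even-dimensional sphere.\<close>

lemma antipodal_not_homotopic_to_square: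
  fixes h :: "'a::euclidean_space \<Rightarrow> 'a"
  assumes odd: "odd DIM('a)"
    and hom: "homotopic_with_canon (\<lambda>_. True) (sphere 0 1) (sphere 0 1) (h \<circ> h) uminus"
    and cont: "continuous_on (sphere 0 1) h" and img: "h \<in> sphere 0 1 \<rightarrow> sphere 0 1"
  shows False
proof -
  define p where "p = DIM('a) - 1"
  have p: "DIM('a) = Suc p" "even p"
    using odd by (auto simp: p_def)
  obtain b where b: "bij_betw b {0..<DIM('a)} (Basis :: 'a set)"
    using ex_bij_betw_nat_finite[of "Basis :: 'a set"] by auto
  then have b: "bij_betw b {..p} (Basis :: 'a set)"
    by (simp add: p atLeast0LessThan lessThan_Suc_atMost)
  \<comment> \<open>\<open>e\<close> and \<open>d\<close> are orthonormal coordinates that identify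
    the unit sphere of \<open>'a\<close> with \<open>nsphere p\<close>; \<open>d\<close> pads with
    zeros above \<open>p\<close>.\<close>
  define e where "e = (\<lambda>x::nat\<Rightarrow>real. \<Sum>i\<le>p. x i *\<^sub>R b i)"
  define d where "d = (\<lambda>v i. if i \<le> p then v \<bullet> b i else 0)"
  define S where "S = {x. (\<Sum>i\<le>p. (x i)\<^sup>2) = 1 \<and> (\<forall>i>p. x i = (0::real))}"
  have nS: "nsphere p = top_of_set S"
    by (simp add: nsphere_eq_top_of_set S_def)
  have bB: "b i \<in> Basis" if "i \<le> p" for i
    using b that by (auto simp: bij_betw_def)
  have bb: "b i \<bullet> b j = (if i = j then 1 else 0)" if "i \<le> p" "j \<le> p" for i j
    using b that by (auto simp: inner_Basis bB bij_betw_def inj_on_eq_iff)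
  have eb: "e x \<bullet> b i = x i" if "i \<le> p" for x i
    using that by (simp add: e_def inner_sum_left bb if_distrib cong: if_cong)
  have de: "d (e x) = x" if "x \<in> S" for x
    using that by (auto simp: d_def eb S_def fun_eq_iff)
  have sumB: "(\<Sum>i\<le>p. g (b i)) = sum g Basis" for g :: "'a \<Rightarrow> 'c::comm_monoid_add"
    by (rule sum.reindex_bij_betw[OF b])
  have ed: "e (d v) = v" for v
  proof -
    have "e (d v) = (\<Sum>i\<le>p. (v \<bullet> b i) *\<^sub>R b i)"
      by (simp add: e_def d_def)
    also have "\<dots> = v"
      using sumB[of "\<lambda>u. (v \<bullet> u) *\<^sub>R u"] by (simp add: euclidean_representation)
    finally show ?thesis .
  qed
  have norm_d: "(\<Sum>i\<le>p. (d v i)\<^sup>2) = (norm v)\<^sup>2" for v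
    using sumB[of "\<lambda>u. (v \<bullet> u)\<^sup>2"]
    unfolding power2_norm_eq_inner euclidean_inner[of v v]
    by (simp add: d_def power2_eq_square)
  have dS: "d v \<in> S" if "v \<in> sphere 0 1" for v
    using that norm_d[of v] by (simp add: S_def) (simp add: d_def)
  have eS: "e x \<in> sphere 0 1" if "x \<in> S" for x
  proof -
    have "(norm (e x))\<^sup>2 = 1"
      using norm_d[of "e x"] de[OF that] that by (simp add: S_def)
    then show ?thesis by (simp add: abs_square_eq_1)
  qed
  have conte: "continuous_map (nsphere p) (top_of_set (sphere 0 1)) e"
    unfolding nS e_def using eS[unfolded e_def]
    by (auto intro!: continuous_intros
        intro: continuous_on_subset[OF continuous_on_product_coordinates])
  have "continuous_on T (\<lambda>v. d v i)" for i T
    by (cases "i \<le> p") (auto simp: d_def intro!: continuous_intros)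
  then have contd: "continuous_map (top_of_set (sphere 0 1)) (nsphere p) d"
    unfolding nS using dS
    by (auto intro!: continuous_on_coordinatewise_then_product)
  have conth: "continuous_map (top_of_set (sphere 0 1)) (top_of_set (sphere 0 1)) h"
    using cont img by auto
  \<comment> \<open>Since \<open>e (d v) = v\<close>, conjugation turns \<open>h \<circ> h\<close>
    into \<open>k \<circ> k\<close>.\<close>
  define k where "k = d \<circ> (h \<circ> e)"
  have contk: "continuous_map (nsphere p) (nsphere p) k"
    unfolding k_def by (intro continuous_map_compose[OF _ contd] continuous_map_compose[OF conte conth])
  have "homotopic_with (\<lambda>_. True) (nsphere p) (nsphere p) (d \<circ> ((h \<circ> h) \<circ> e)) (d \<circ> (uminus \<circ> e))"
    by (intro homotopic_with_compose_continuous_map_left[OF _ contd]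
        homotopic_with_compose_continuous_map_right[OF hom conte]) auto
  moreover have "d \<circ> ((h \<circ> h) \<circ> e) = k \<circ> k"
    by (simp add: k_def fun_eq_iff ed)
  moreover have "Brouwer_degree2 p (d \<circ> (uminus \<circ> e)) = Brouwer_degree2 p (\<lambda>x i. - x i)"
  proof (rule Brouwer_degree2_eq)
    fix x assume "x \<in> topspace (nsphere p)"
    then have "x \<in> S" by (simp add: nS)
    then show "(d \<circ> (uminus \<circ> e)) x = (\<lambda>i. - x i)"
      by (auto simp: d_def eb S_def fun_eq_iff)
  qed
  ultimately have "Brouwer_degree2 p k * Brouwer_degree2 p k = -1"
    using Brouwer_degree2_homotopic Brouwer_degree2_compose[OF contk contk]
    by (fastforce simp: Brouwer_degree2_antipodal p)
  then show False
    by (metis zero_le_square not_le neg_less_0_iff_less zero_less_one)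
qed

section \<open>Local square roots of a reversal\<close>

text \<open>On a small sphere around \<open>a\<close>, the displacement of
  \<open>f \<circ> f\<close> from \<open>a\<close> never points along \<open>v\<close>, so it
  deforms linearly to \<open>- v\<close>. Normalising the displacement of \<open>f\<close> gives a
  self-map of the sphere whose square is homotopic to the antipode.\<close>

lemma no_local_square_root_of_reversal:
  fixes f :: "'a::euclidean_space \<Rightarrow> 'a"
  assumes odd: "odd DIM('a)" and U: "open U" "a \<in> U" and cont: "continuous_on U f"
    and fa: "f a = a" and iso: "\<And>x. x \<in> U \<Longrightarrow> x \<noteq> a \<Longrightarrow> f x \<noteq> a"
    and rev: "\<And>x c. x \<in> U \<Longrightarrow> x \<noteq> a \<Longrightarrow> f x \<in> U \<Longrightarrow> c \<ge> 0 \<Longrightarrow> f (f x) - a \<noteq> c *\<^sub>R (x - a)"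
  shows False
proof -
  obtain r where r: "r > 0" "cball a r \<subseteq> U"
    using U open_contains_cball by blast
  have "isCont f a"
    using cont U by (simp add: continuous_on_eq_continuous_at)
  then obtain e where e: "e > 0" "\<And>x. dist x a < e \<Longrightarrow> dist (f x) a < r"
    using r(1) fa unfolding continuous_at_eps_delta by metis
  \<comment> \<open>Halving \<open>e\<close> makes \<open>\<delta> < e\<close> strict, so continuity
    at \<open>a\<close> controls \<open>f\<close> on the whole sphere of radius
    \<open>\<delta>\<close>.\<close>
  define \<delta> where "\<delta> = min r (e / 2)"
  have \<delta>: "\<delta> > 0" "\<delta> \<le> r" "\<delta> < e"
    using r e by (auto simp: \<delta>_def)
  let ?S = "sphere (0::'a) 1"
  define w where "w = (\<lambda>v. f (a + \<delta> *\<^sub>R v) - a)"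
  define H where "H = (\<lambda>v. sgn (w v))"
  define t where "t = (\<lambda>s v. (1 - s) * (\<delta> / norm (w v)) + s)"
  have inU: "a + x \<in> U" if "norm x \<le> r" for x
    using r that by (auto simp: dist_norm subset_iff)
  have dv: "a + \<delta> *\<^sub>R v \<in> U" "a + \<delta> *\<^sub>R v \<noteq> a" if "v \<in> ?S" for v
    using that \<delta> by (auto intro!: inU)
  have w0: "w v \<noteq> 0" if "v \<in> ?S" for v
    using iso[OF dv[OF that]] by (simp add: w_def)
  have wr: "norm (w v) \<le> r" if "v \<in> ?S" for v
    using e(2)[of "a + \<delta> *\<^sub>R v"] that \<delta> by (simp add: w_def dist_norm)
  have contw: "continuous_on ?S w"
    unfolding w_def using dv
    by (intro continuous_intros continuous_on_compose2[OF cont]) auto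
  have contH: "continuous_on ?S H"
    unfolding H_def sgn_div_norm using w0 by (intro continuous_intros contw) auto
  have HS: "H \<in> ?S \<rightarrow> ?S"
    using w0 by (auto simp: H_def norm_sgn)
  \<comment> \<open>The norm is a convex combination of \<open>\<delta>\<close> and
    \<open>norm (w v)\<close>, both at most \<open>r\<close>. Positivity keeps the argument of
    \<open>f\<close> in \<open>K\<close> away from \<open>a\<close>, the bound keeps it in
    \<open>U\<close>.\<close>
  have t: "0 < t s v" "norm (t s v *\<^sub>R w v) \<le> r" if "s \<in> {0..1}" "v \<in> ?S" for s v
  proof -
    have pos: "\<delta> / norm (w v) > 0"
      using w0[OF that(2)] \<delta> by simp
    show "0 < t s v"
      unfolding t_def using that(1) pos
      by (cases "s = 0") (auto intro!: add_nonneg_pos mult_nonneg_nonneg simp del: times_divide_eq_right)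
    then have "norm (t s v *\<^sub>R w v) = (1 - s) * \<delta> + s * norm (w v)"
      using w0[OF that(2)] by (simp add: t_def field_simps)
    also have "\<dots> \<le> (1 - s) * r + s * r"
      using that(1) \<delta>(2) wr[OF that(2)] by (intro add_mono mult_left_mono) auto
    finally show "norm (t s v *\<^sub>R w v) \<le> r"
      by (simp add: algebra_simps)
  qed
  \<comment> \<open>\<open>t\<close> moves from radial projection onto the sphere of radius \<open>\<delta>\<close>, which gives
    \<open>H \<circ> H\<close>, to the identity, which gives \<open>f \<circ> f\<close>.\<close>
  define K where "K = (\<lambda>(s, v). f (a + t s v *\<^sub>R w v) - a)"
  have contK: "continuous_on ({0..1} \<times> ?S) K"
  proof -
    have "continuous_on ({0..1} \<times> ?S) (\<lambda>z. w (snd z))"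
      by (intro continuous_on_compose2[OF contw] continuous_intros) auto
    then have "continuous_on ({0..1} \<times> ?S) (\<lambda>z. a + t (fst z) (snd z) *\<^sub>R w (snd z))"
      unfolding t_def using w0 by (intro continuous_intros) auto
    then show ?thesis
      unfolding K_def case_prod_unfold using t(2)
      by (intro continuous_on_diff continuous_on_const continuous_on_compose2[OF cont])
        (auto intro!: inU)
  qed
  have K0: "K (s, v) \<noteq> 0" if "s \<in> {0..1}" "v \<in> ?S" for s v
    using iso[OF inU[OF t(2)[OF that]]] t(1)[OF that] w0[OF that(2)] by (simp add: K_def)
  \<comment> \<open>Unfolding \<open>w\<close>, this is
    \<open>f (f (a + \<delta> *\<^sub>R v)) - a\<close>.\<close>
  define g where "g = (\<lambda>v. f (a + w v) - a)"
  have first: "homotopic_with_canon (\<lambda>_. True) ?S (- {0}) (\<lambda>v. K (0, v)) g"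
    unfolding homotopic_with_def
    by (rule exI[of _ K])
      (use contK K0 in \<open>auto simp: prod_topology_subtopology_eu K_def g_def t_def\<close>)
  have "homotopic_with_canon (\<lambda>_. True) ?S (- {0}) g uminus"
  proof (rule homotopic_with_linear)
    show "continuous_on ?S g"
      unfolding g_def using wr
      by (intro continuous_intros continuous_on_compose2[OF cont] contw) (auto intro!: inU)
    show "continuous_on ?S uminus"
      by (intro continuous_intros)
    fix v assume v: "v \<in> ?S"
    show "closed_segment (g v) (- v) \<subseteq> - {0}"
    proof
      fix x assume "x \<in> closed_segment (g v) (- v)"
      then obtain u where u: "0 \<le> u" "u \<le> 1" "x = (1 - u) *\<^sub>R g v + u *\<^sub>R (- v)"
        by (auto simp: in_segment)
      \<comment> \<open>A segment from \<open>g v\<close> to \<open>- v\<close> through 0 would make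
        \<open>g v\<close> a nonnegative multiple of \<open>v\<close>, against
        \<open>rev\<close>.\<close>
      have "x \<noteq> 0"
      proof
        assume "x = 0"
        then have eq: "(1 - u) *\<^sub>R g v = u *\<^sub>R v"
          using u by simp
        have "u \<noteq> 1"
          using eq v by auto
        then have "g v = (u / (1 - u)) *\<^sub>R v"
          using arg_cong[OF eq, of "scaleR (1 / (1 - u))"] by simp
        then have "g v = (u / (1 - u) / \<delta>) *\<^sub>R (a + \<delta> *\<^sub>R v - a)"
          using \<delta> by simp
        moreover have "f (a + \<delta> *\<^sub>R v) \<in> U"
          using inU[OF wr[OF v]] by (simp add: w_def)
        ultimately show False
          using rev[OF dv[OF v], of "u / (1 - u) / \<delta>"] u \<delta> by (simp add: g_def w_def)
      qed
      then show "x \<in> - {0}" by simp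
    qed
  qed
  with first have "homotopic_with_canon (\<lambda>_. True) ?S (- {0}) (\<lambda>v. K (0, v)) uminus"
    by (rule homotopic_with_trans)
  \<comment> \<open>\<open>K (0, v)\<close> equals \<open>w (H v)\<close>, so composing with
    \<open>sgn\<close> gives \<open>H (H v)\<close>.\<close>
  moreover have "continuous_map (top_of_set (- {0})) (top_of_set ?S) (sgn :: 'a \<Rightarrow> 'a)"
    by (auto simp: sgn_div_norm intro!: continuous_intros)
  ultimately have "homotopic_with_canon (\<lambda>_. True) ?S ?S (sgn \<circ> (\<lambda>v. K (0, v))) (sgn \<circ> uminus)"
    by (rule homotopic_with_compose_continuous_map_left) auto
  then have "homotopic_with_canon (\<lambda>_. True) ?S ?S (H \<circ> H) uminus"
    by (rule homotopic_with_eq)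
      (auto simp: H_def w_def K_def t_def sgn_div_norm divide_inverse)
  then show False
    using antipodal_not_homotopic_to_square[OF odd _ contH HS] by blast
qed

section \<open>Involutions in the general linear group\<close>

lemma matrix_sub_ldistrib: "(A :: 'a::ring_1 ^'n^'m) ** (B - C) = A ** B - A ** C"
  by (vector matrix_matrix_mult_def sum_subtractf[symmetric] algebra_simps)

lemma matrix_sub_rdistrib: "((A :: 'a::ring_1 ^'n^'m) - B) ** C = A ** C - B ** C"
  by (vector matrix_matrix_mult_def sum_subtractf[symmetric] algebra_simps)

lemma matrix_add_rdistrib: "((A :: 'a::ring_1 ^'n^'m) + B) ** C = A ** C + B ** C"
  by (vector matrix_matrix_mult_def sum.distrib[symmetric] algebra_simps)

text \<open>With \<open>X\<close> the matrix unit at \<open>(j, k)\<close>, entry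
  \<open>(i, l)\<close> of the product is \<open>A $ i $ j * B $ k $ l\<close>.\<close>

lemma matrix_sandwich_zero:
  fixes A :: "'a::ring_1_no_zero_divisors ^'n^'m" and B :: "'a ^'l^'k"
  assumes "\<And>X. A ** X ** B = 0"
  shows "A = 0 \<or> B = 0"
proof (rule ccontr)
  assume "\<not> (A = 0 \<or> B = 0)"
  then obtain i j k l where nz: "A $ i $ j \<noteq> 0" "B $ k $ l \<noteq> 0"
    by (auto simp: vec_eq_iff)
  define X :: "'a^'k^'n" where "X = (\<chi> a b. if a = j \<and> b = k then 1 else 0)"
  have "(A ** X) $ i $ b = (if b = k then A $ i $ j else 0)" for b
    by (simp add: matrix_matrix_mult_def X_def if_distrib cong: if_cong)
  then have "(A ** X ** B) $ i $ l = (\<Sum>b\<in>UNIV. (if b = k then A $ i $ j else 0) * B $ b $ l)"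
    unfolding matrix_matrix_mult_def[of "A ** X" B] by (simp del: mult_zero_left)
  also have "\<dots> = (\<Sum>b\<in>UNIV. if b = k then A $ i $ j * B $ b $ l else 0)"
    by (rule sum.cong) auto
  finally have "(A ** X ** B) $ i $ l = A $ i $ j * B $ k $ l"
    by simp
  with nz assms show False by simp
qed

lemma open_det_pos: "open {A :: real^'n^'n. det A > 0}"
  unfolding det_def by (intro open_Collect_less continuous_intros)

text \<open>With \<open>y = x\<close> and \<open>c = 1\<close> this also says that the identity is an isolated involution.\<close>

lemma inverse_reverses_near_identity:
  obtains r where "r > 0" "ball (mat 1 :: real^'n^'n) r \<subseteq> {A. det A > 0}"
    "\<And>(x :: real^'n^'n) y c. \<lbrakk>x \<in> ball (mat 1) r; x ** y = mat 1; c \<ge> 0;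
        y - mat 1 = c *\<^sub>R (x - mat 1)\<rbrakk> \<Longrightarrow> x = mat 1"
proof -
  obtain r where r: "r > 0" "ball (mat 1 :: real^'n^'n) r \<subseteq> {A. det A > 0}"
    using open_det_pos[where 'n='n] unfolding open_contains_ball
    by (metis (mono_tags, lifting) det_I mem_Collect_eq zero_less_one)
  moreover have "x = mat 1" if x: "x \<in> ball (mat 1) r" and xy: "x ** y = mat 1" and c: "c \<ge> 0"
    and eq: "y - mat 1 = c *\<^sub>R (x - mat 1)" for x y :: "real^'n^'n" and c
  proof -
    \<comment> \<open>Multiplying the hypothesis on \<open>y\<close> by \<open>x\<close> gives
      \<open>(x - mat 1) ** (mat 1 + c *\<^sub>R x) = 0\<close>. Divided by \<open>1 + c\<close>,
      the second factor is a convex combination of \<open>mat 1\<close> and \<open>x\<close>, hence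
      in the ball and invertible.\<close>
    let ?z = "(1 / (1 + c)) *\<^sub>R mat 1 + (c / (1 + c)) *\<^sub>R x"
    have yx: "y ** x = mat 1"
      using xy matrix_left_right_inverse by blast
    have "?z \<in> ball (mat 1) r"
      using x r c by (intro convexD[OF convex_ball]) (auto simp: field_simps)
    then have "det ?z > 0" using r by blast
    then obtain w where w: "?z ** w = mat 1"
      using invertible_det_nz[of ?z] unfolding invertible_def by auto
    have "(y - mat 1) ** x = c *\<^sub>R (x - mat 1) ** x"
      by (simp add: eq)
    then have "(x - mat 1) + c *\<^sub>R ((x - mat 1) ** x) = 0"
      by (simp add: matrix_sub_rdistrib yx scaleR_right_diff_distrib algebra_simps flip: scalar_matrix_assoc)
    then have "(1 / (1 + c)) *\<^sub>R ((x - mat 1) + c *\<^sub>R ((x - mat 1) ** x)) = 0"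
      by simp
    then have "(x - mat 1) ** ?z = 0"
      by (simp add: matrix_add_ldistrib matrix_scalar_ac scaleR_right_distrib flip: scalar_matrix_assoc)
    then have "(x - mat 1) ** (?z ** w) = 0"
      by (simp add: matrix_mul_assoc)
    then show ?thesis by (simp add: w)
  qed
  ultimately show thesis using that by blast
qed

text \<open>From \<open>p ** N = N\<close> and \<open>N ** p = - N\<close> the terms linear in
  \<open>s\<close> cancel, and \<open>N ** N = 0\<close> removes the quadratic one. A suitable
  \<open>X\<close> exists because both outer factors of \<open>N\<close> are nonzero.\<close>

lemma involution_not_isolated:
  fixes p :: "real^'n^'n"
  assumes pp: "p ** p = mat 1" and "p \<noteq> mat 1" "p \<noteq> - mat 1"
  obtains N where "N \<noteq> 0" "\<And>s. (p + s *\<^sub>R N) ** (p + s *\<^sub>R N) = mat 1"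
proof -
  have "mat 1 + p \<noteq> 0" "mat 1 - p \<noteq> 0"
    using assms by (auto simp: add_eq_0_iff)
  then obtain X where X: "(mat 1 + p) ** X ** (mat 1 - p) \<noteq> 0"
    using matrix_sandwich_zero by blast
  define N where "N = (mat 1 + p) ** X ** (mat 1 - p)"
  have pN: "p ** N = N"
    by (simp add: N_def matrix_mul_assoc matrix_add_ldistrib pp add.commute)
  have Np: "N ** p = - N"
    unfolding N_def
    by (simp add: matrix_sub_rdistrib pp matrix_sub_ldistrib flip: matrix_mul_assoc)
  have "N ** (mat 1 + p) = 0"
    by (simp add: matrix_add_ldistrib Np)
  then have NN: "N ** N = 0"
    by (simp add: N_def matrix_mul_assoc)
  have "(p + s *\<^sub>R N) ** (p + s *\<^sub>R N) = mat 1" for s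
    by (simp add: matrix_add_ldistrib matrix_add_rdistrib pp pN Np NN matrix_scalar_ac
        flip: scalar_matrix_assoc)
  with X show thesis using that N_def by blast
qed

section \<open>Continuous inverse ambiguous functions for odd n\<close>

theorem theorem5p6:
  assumes "odd CARD('n::finite)"
  shows "\<not> (\<exists>f :: real ^ 'n ^ 'n \<Rightarrow> real ^ 'n ^ 'n.
            continuous_on (carrier GL_pos) f \<and> inverse_ambiguous GL_pos f)"
proof
  assume "\<exists>f :: real ^ 'n ^ 'n \<Rightarrow> real ^ 'n ^ 'n.
            continuous_on (carrier GL_pos) f \<and> inverse_ambiguous GL_pos f"
  then obtain f :: "real ^ 'n ^ 'n \<Rightarrow> real ^ 'n ^ 'n" where
    "continuous_on (carrier GL_pos) f" and ia: "inverse_ambiguous GL_pos f" by blast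
  define G where "G = {A :: real^'n^'n. det A > 0}"
  have car: "carrier GL_pos = G" by (simp add: GL_pos_def G_def)
  have cont: "continuous_on G f" using \<open>continuous_on (carrier GL_pos) f\<close> car by simp
  interpret group "GL_pos :: (real ^ 'n ^ 'n) monoid" by (rule group_GL_pos)
  have fG: "f \<in> G \<rightarrow> G"
    using ia by (auto simp: inverse_ambiguous_def bij_betw_def car)
  have ff: "x ** f (f x) = mat 1" if "x \<in> G" for x
  proof -
    have "f (f x) = inv\<^bsub>GL_pos\<^esub> x"
      using ia inverse_ambiguous_iff[OF group_GL_pos, of f] fG that by (simp add: car)
    moreover have "x \<otimes>\<^bsub>GL_pos\<^esub> y = x ** y" for y
      by (simp add: GL_pos_def)
    moreover have "\<one>\<^bsub>GL_pos\<^esub> = (mat 1 :: real^'n^'n)"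
      by (simp add: GL_pos_def)
    ultimately show ?thesis
      using r_inv[of x] that by (simp add: car)
  qed
  have inj: "x = y" if "x \<in> G" "y \<in> G" "f x = f y" for x y
    using ia that by (auto simp: inverse_ambiguous_def bij_betw_def car dest: inj_onD)
  have ff_inv: "f (f x) = x" if "x \<in> G" "x ** x = mat 1" for x
    using ff[OF that(1)] that(2) by (metis matrix_mul_assoc matrix_mul_lid)
  \<comment> \<open>Apply \<open>ff\<close> to \<open>f x\<close> and use
    \<open>f (f x) = x\<close>.\<close>
  have f_inv: "f x ** f x = mat 1" if "x \<in> G" "x ** x = mat 1" for x
    using ff[of "f x"] ff_inv[OF that] fG that(1) by auto
  have opG: "open G" unfolding G_def by (rule open_det_pos)
  obtain r where r: "r > 0" "ball (mat 1 :: real^'n^'n) r \<subseteq> G"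
    "\<And>(x :: real^'n^'n) y c. \<lbrakk>x \<in> ball (mat 1) r; x ** y = mat 1; c \<ge> 0;
        y - mat 1 = c *\<^sub>R (x - mat 1)\<rbrakk> \<Longrightarrow> x = mat 1"
    unfolding G_def by (rule inverse_reverses_near_identity) blast
  have 1: "mat 1 \<in> G" by (simp add: G_def)
  define p where "p = f (mat 1)"
  have pG: "p \<in> G" using fG 1 by (auto simp: p_def)
  have pp: "p ** p = mat 1" using f_inv[OF 1] by (simp add: p_def)
  have fp: "f p = mat 1" using ff_inv[OF 1] by (simp add: p_def)
  have "p = mat 1"
  proof (rule ccontr)
    assume "p \<noteq> mat 1"
    moreover have "p \<noteq> - mat 1"
    proof
      \<comment> \<open>For odd n the matrix \<open>- mat 1\<close> has determinant -1, so it lies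
        outside \<open>G\<close>.\<close>
      assume "p = - mat 1"
      then have "p = matrix ((*\<^sub>R) (-1))"
        by (simp add: matrix_scaleR) (simp add: mat_def vec_eq_iff)
      then have "det p = -1"
        using assms by (simp only: det_matrix_scaleR) simp
      then show False using pG by (simp add: G_def)
    qed
    ultimately obtain N where N: "N \<noteq> 0" "\<And>s. (p + s *\<^sub>R N) ** (p + s *\<^sub>R N) = mat 1"
      using involution_not_isolated[OF pp] by blast
    \<comment> \<open>The involutions \<open>?q s\<close> tend to \<open>p\<close>, so their images
      are involutions tending to \<open>mat 1\<close>. Isolation makes these images equal to
      \<open>mat 1\<close>, contradicting injectivity.\<close>
    let ?q = "\<lambda>s. p + s *\<^sub>R N"
    have q: "(?q \<longlongrightarrow> p) (at 0)"
      by (rule tendsto_eq_intros refl | simp)+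
    have "isCont f p"
      using cont opG pG by (simp add: continuous_on_eq_continuous_at)
    then have "((\<lambda>s. f (?q s)) \<longlongrightarrow> mat 1) (at 0)"
      using isCont_tendsto_compose[OF _ q, of f] fp by simp
    then have "\<forall>\<^sub>F s in at 0. f (?q s) \<in> ball (mat 1) r"
      by (rule topological_tendstoD) (use r in auto)
    moreover have "\<forall>\<^sub>F s in at 0. ?q s \<in> G"
      by (rule topological_tendstoD[OF q opG pG])
    moreover have "\<forall>\<^sub>F s in at (0::real). s \<noteq> 0"
      by (simp add: eventually_at_filter)
    ultimately have "\<forall>\<^sub>F s in at (0::real). False"
    proof eventually_elim
      case (elim s)
      have "f (?q s) = mat 1"
        \<comment> \<open>With \<open>c = 1\<close> and both matrices equal to
          \<open>f (?q s)\<close>, this is the isolation of \<open>mat 1\<close> among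
          involutions.\<close>
        by (rule r(3)[OF elim(1) f_inv[OF elim(2) N(2)], of 1]) auto
      then have "?q s = p"
        using fp inj elim(2) pG by metis
      then show False using N elim by simp
    qed
    then show False by simp
  qed
  then have f1: "f (mat 1) = mat 1" by (simp add: p_def)
  have sub: "x \<in> ball (mat 1) r \<Longrightarrow> x \<in> G" for x using r(2) by blast
  show False
  proof (rule no_local_square_root_of_reversal[of "ball (mat 1) r" "mat 1" f])
    \<comment> \<open>The dimension is the square of \<open>CARD('n)\<close>.\<close>
    show "odd DIM(real^'n^'n)" using assms by simp
    show "continuous_on (ball (mat 1) r) f" by (rule continuous_on_subset[OF cont r(2)])
    show "f x \<noteq> mat 1" if "x \<in> ball (mat 1) r" "x \<noteq> mat 1" for x
      using inj[OF sub[OF that(1)] 1] that f1 by auto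
    \<comment> \<open>By \<open>ff\<close>, \<open>f (f x)\<close> is the inverse of
      \<open>x\<close>, and inversion reverses directions near \<open>mat 1\<close>.\<close>
    show "f (f x) - mat 1 \<noteq> c *\<^sub>R (x - mat 1)"
      if "x \<in> ball (mat 1) r" "x \<noteq> mat 1" "c \<ge> 0" for x c
      using r(3)[OF that(1) ff[OF sub[OF that(1)]] that(3)] that(2) by blast
  qed (use r f1 in auto)
qed

end
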